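(* Let $G$ be a residually nilpotent group, and let $\{\gamma_n(G)\}_{n\geq 1}$ be its lower central series. If $\mathcal{V}_\omega(\mathbb{Z}[G/\gamma_n(G)])=\{1\}$ for all $n\geq 1$, then $\mathcal{V}_\omega(\mathbb{Z}G)=\{1\}$.
   Context: For a group $G$, $\mathbb{Z}G=\mathbb{Z}[G]$ is the integral group ring, $\Delta(G)$ is its augmentation ideal, and $\Delta^n(G)$ is the $n$-th power of this ideal. $\mathcal{V}(\mathbb{Z}G)$ is the group of units of augmentation one in $\mathbb{Z}G$; for $n\ge 1$, $\mathcal{V}_n(\mathbb{Z}G)=\mathcal{V}(\mathbb{Z}G)\cap(1+\Delta^n(G))$; and $\mathcal{V}_\omega(\mathbb{Z}G)=\bigcap_{n=1}^\infty\mathcal{V}_n(\mathbb{Z}G)$. A group $G$ is residually nilpotent if for every $1\ne x\in G$ there is a normal subgroup $N_x$ of $G$ with $x\notin N_x$ and $G/N_x$ nilpotent; equivalently $\bigcap_{n\ge1}\gamma_n(G)=\{1\}$. *)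

theory Defs
  imports "HOL-Algebra.Free_Abelian_Groups" "HOL-Algebra.Ideal_Product" "HOL-Algebra.Generated_Groups"
begin

section \<open>Lower central series, nilpotent and residually nilpotent groups\<close>

definition commutator_subgroup ::
  "('a, 'b) monoid_scheme \<Rightarrow> 'a set \<Rightarrow> 'a set \<Rightarrow> 'a set" where
  "commutator_subgroup G H K =
     generate G (\<Union>h\<in>H. \<Union>k\<in>K. {h \<otimes>\<^bsub>G\<^esub> k \<otimes>\<^bsub>G\<^esub> inv\<^bsub>G\<^esub> h \<otimes>\<^bsub>G\<^esub> inv\<^bsub>G\<^esub> k})"

text \<open>The series is indexed from 1; the value at 0 is the junk value \<^term>\<open>carrier G\<close>.\<close>

definition lower_central :: "('a, 'b) monoid_scheme \<Rightarrow> nat \<Rightarrow> 'a set" where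
  "lower_central G n = ((\<lambda>H. commutator_subgroup G H (carrier G)) ^^ (n - 1)) (carrier G)"

definition nilpotent_group :: "('a, 'b) monoid_scheme \<Rightarrow> bool" where
  "nilpotent_group G \<longleftrightarrow> group G \<and> (\<exists>n\<ge>1. lower_central G n = {\<one>\<^bsub>G\<^esub>})"

definition residually_nilpotent :: "('a, 'b) monoid_scheme \<Rightarrow> bool" where
  "residually_nilpotent G \<longleftrightarrow> group G \<and>
     (\<forall>x\<in>carrier G. x \<noteq> \<one>\<^bsub>G\<^esub> \<longrightarrow> (\<exists>N. N \<lhd> G \<and> x \<notin> N \<and> nilpotent_group (G Mod N)))"


section \<open>The integral group ring\<close>

text \<open>
  Elements are finitely supported integer combinations of elements of \<^term>\<open>carrier G\<close>, as in
  \<^const>\<open>free_Abelian_group\<close>. Multiplication is the bilinear extension of the multiplication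
  of \<open>G\<close>, since \<^term>\<open>frag_extend f\<close> is the additive extension of \<open>f\<close>.
\<close>

definition group_ring :: "('a, 'b) monoid_scheme \<Rightarrow> ('a \<Rightarrow>\<^sub>0 int) ring" where
  "group_ring G =
     \<lparr>carrier = {a. Poly_Mapping.keys a \<subseteq> carrier G},
      monoid.mult = (\<lambda>a b. frag_extend (\<lambda>x. frag_extend (\<lambda>y. frag_of (x \<otimes>\<^bsub>G\<^esub> y)) b) a),
      one = frag_of \<one>\<^bsub>G\<^esub>,
      ring.zero = 0,
      ring.add = (+)\<rparr>"

definition augmentation :: "('a \<Rightarrow>\<^sub>0 int) \<Rightarrow> int" where
  "augmentation a = (\<Sum>x\<in>Poly_Mapping.keys a. Poly_Mapping.lookup a x)"

definition augmentation_ideal :: "('a, 'b) monoid_scheme \<Rightarrow> ('a \<Rightarrow>\<^sub>0 int) set" where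
  "augmentation_ideal G = {a \<in> carrier (group_ring G). augmentation a = 0}"

text \<open>
  Powers are taken in the monoid of ideals \<^const>\<open>ideals_set\<close>, whose multiplication is
  \<^const>\<open>ideal_prod\<close>.
\<close>

definition augmentation_power :: "('a, 'b) monoid_scheme \<Rightarrow> nat \<Rightarrow> ('a \<Rightarrow>\<^sub>0 int) set" where
  "augmentation_power G n = augmentation_ideal G [^]\<^bsub>ideals_set (group_ring G)\<^esub> n"


section \<open>Normalized units\<close>

definition normalized_units :: "('a, 'b) monoid_scheme \<Rightarrow> ('a \<Rightarrow>\<^sub>0 int) set" where
  "normalized_units G = {u \<in> Units (group_ring G). augmentation u = 1}"

definition normalized_units_level ::
  "('a, 'b) monoid_scheme \<Rightarrow> nat \<Rightarrow> ('a \<Rightarrow>\<^sub>0 int) set" where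
  "normalized_units_level G n =
     normalized_units G \<inter> (\<one>\<^bsub>group_ring G\<^esub> <+\<^bsub>group_ring G\<^esub> augmentation_power G n)"

definition normalized_units_omega :: "('a, 'b) monoid_scheme \<Rightarrow> ('a \<Rightarrow>\<^sub>0 int) set" where
  "normalized_units_omega G = (\<Inter>n\<in>{1..}. normalized_units_level G n)"


section \<open>Well-formedness\<close>

lemma augmentation_eq_sum:
  assumes "finite A" "Poly_Mapping.keys a \<subseteq> A"
  shows "augmentation a = (\<Sum>x\<in>A. Poly_Mapping.lookup a x)"
  unfolding augmentation_def
  by (rule sum.mono_neutral_left) (use assms in \<open>auto simp: in_keys_iff\<close>)

lemma augmentation_zero [simp]: "augmentation 0 = 0"
  by (simp add: augmentation_def)

lemma augmentation_frag_of [simp]: "augmentation (frag_of x) = 1"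
  by (simp add: augmentation_def)

lemma augmentation_add: "augmentation (a + b) = augmentation a + augmentation b"
proof -
  let ?A = "Poly_Mapping.keys a \<union> Poly_Mapping.keys b"
  have "augmentation (a + b) = (\<Sum>x\<in>?A. Poly_Mapping.lookup (a + b) x)"
    by (rule augmentation_eq_sum) (auto simp: Poly_Mapping.keys_add)
  then show ?thesis
    by (simp add: lookup_add sum.distrib augmentation_eq_sum[of ?A])
qed

lemma augmentation_diff: "augmentation (a - b) = augmentation a - augmentation b"
  using augmentation_add[of "a - b" b] by simp

lemma augmentation_frag_extend:
  assumes "\<And>x. x \<in> Poly_Mapping.keys a \<Longrightarrow> augmentation (f x) = c"
  shows "augmentation (frag_extend f a) = augmentation a * c"
  by (rule frag_induction[of a "Poly_Mapping.keys a"])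
     (use assms in \<open>auto simp: frag_extend_diff augmentation_diff algebra_simps\<close>)

lemma augmentation_mult:
  "augmentation (a \<otimes>\<^bsub>group_ring G\<^esub> b) = augmentation a * augmentation b"
  by (simp add: group_ring_def augmentation_frag_extend)

lemma keys_group_ring_mult:
  assumes "monoid G" "Poly_Mapping.keys a \<subseteq> carrier G" "Poly_Mapping.keys b \<subseteq> carrier G"
  shows "Poly_Mapping.keys (a \<otimes>\<^bsub>group_ring G\<^esub> b) \<subseteq> carrier G"
proof -
  interpret monoid G by fact
  show ?thesis
    unfolding group_ring_def using assms(2,3)
    by simp (rule order_trans[OF keys_frag_extend] UN_least | force)+
qed

lemma group_ring_mult_diff_left:
  "(a - b) \<otimes>\<^bsub>group_ring G\<^esub> c = a \<otimes>\<^bsub>group_ring G\<^esub> c - b \<otimes>\<^bsub>group_ring G\<^esub> c"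
  by (simp add: group_ring_def frag_extend_diff)

lemma group_ring_mult_diff_right:
  "a \<otimes>\<^bsub>group_ring G\<^esub> (b - c) = a \<otimes>\<^bsub>group_ring G\<^esub> b - a \<otimes>\<^bsub>group_ring G\<^esub> c"
  using subset_UNIV[of "Poly_Mapping.keys a"]
  by (induction rule: frag_induction) (auto simp: group_ring_def frag_extend_diff)

lemma group_ring_mult_zero [simp]:
  "0 \<otimes>\<^bsub>group_ring G\<^esub> c = 0" "c \<otimes>\<^bsub>group_ring G\<^esub> 0 = 0"
  using group_ring_mult_diff_left[of G 0 0 c] group_ring_mult_diff_right[of G c 0 0] by simp_all

lemma group_ring_mult_frag_of:
  "frag_of x \<otimes>\<^bsub>group_ring G\<^esub> frag_of y = frag_of (x \<otimes>\<^bsub>G\<^esub> y)"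
  by (simp add: group_ring_def)

lemma group_ring_mult_assoc:
  assumes "monoid G" "Poly_Mapping.keys a \<subseteq> carrier G" "Poly_Mapping.keys b \<subseteq> carrier G"
    "Poly_Mapping.keys c \<subseteq> carrier G"
  shows "a \<otimes>\<^bsub>group_ring G\<^esub> b \<otimes>\<^bsub>group_ring G\<^esub> c
       = a \<otimes>\<^bsub>group_ring G\<^esub> (b \<otimes>\<^bsub>group_ring G\<^esub> c)"
proof -
  interpret monoid G by fact
  have 1: "frag_of x \<otimes>\<^bsub>group_ring G\<^esub> frag_of y \<otimes>\<^bsub>group_ring G\<^esub> c
         = frag_of x \<otimes>\<^bsub>group_ring G\<^esub> (frag_of y \<otimes>\<^bsub>group_ring G\<^esub> c)"
    if "x \<in> carrier G" "y \<in> carrier G" for x y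
    using assms(4)
    by (induction rule: frag_induction)
       (use that in \<open>auto simp: group_ring_mult_diff_right group_ring_mult_frag_of m_assoc\<close>)
  have 2: "frag_of x \<otimes>\<^bsub>group_ring G\<^esub> b \<otimes>\<^bsub>group_ring G\<^esub> c
         = frag_of x \<otimes>\<^bsub>group_ring G\<^esub> (b \<otimes>\<^bsub>group_ring G\<^esub> c)"
    if "x \<in> carrier G" for x
    using assms(3)
    by (induction rule: frag_induction)
       (use that 1 in \<open>auto simp: group_ring_mult_diff_left group_ring_mult_diff_right\<close>)
  show ?thesis
    using assms(2)
    by (induction rule: frag_induction) (use 2 in \<open>auto simp: group_ring_mult_diff_left\<close>)
qed

lemma group_ring_is_ring:
  assumes "monoid G"
  shows "ring (group_ring G)"
proof -
  interpret monoid G by fact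
  have sel: "carrier (group_ring G) = {a. Poly_Mapping.keys a \<subseteq> carrier G}"
    "\<one>\<^bsub>group_ring G\<^esub> = frag_of \<one>\<^bsub>G\<^esub>" "\<zero>\<^bsub>group_ring G\<^esub> = 0"
    "\<And>a b. a \<oplus>\<^bsub>group_ring G\<^esub> b = a + b"
    by (simp_all add: group_ring_def)
  have add: "Poly_Mapping.keys (a + b) \<subseteq> S"
    if "Poly_Mapping.keys a \<subseteq> S" "Poly_Mapping.keys b \<subseteq> S" for a b :: "'a \<Rightarrow>\<^sub>0 int" and S
    using Poly_Mapping.keys_add[of a b] that by blast
  show ?thesis
  proof (rule ringI)
    show "abelian_group (group_ring G)"
    proof (rule abelian_groupI)
      show "\<exists>y\<in>carrier (group_ring G). y \<oplus>\<^bsub>group_ring G\<^esub> x = \<zero>\<^bsub>group_ring G\<^esub>"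
        if "x \<in> carrier (group_ring G)" for x
        using that by (intro bexI[of _ "- x"]) (auto simp: sel)
    qed (auto simp: sel algebra_simps add[THEN subsetD])
  next
    show "monoid (group_ring G)"
    proof (rule monoidI)
      fix x assume "x \<in> carrier (group_ring G)"
      then have x: "Poly_Mapping.keys x \<subseteq> carrier G" by (simp add: sel)
      show "\<one>\<^bsub>group_ring G\<^esub> \<otimes>\<^bsub>group_ring G\<^esub> x = x"
        using x by (induction rule: frag_induction)
          (auto simp: sel group_ring_mult_diff_right group_ring_mult_frag_of)
      show "x \<otimes>\<^bsub>group_ring G\<^esub> \<one>\<^bsub>group_ring G\<^esub> = x"
        using x by (induction rule: frag_induction)
          (auto simp: sel group_ring_mult_diff_left group_ring_mult_frag_of)
    qed (use keys_group_ring_mult[OF assms] group_ring_mult_assoc[OF assms] in \<open>auto simp: sel\<close>)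
  next
    fix x y z
    show "(x \<oplus>\<^bsub>group_ring G\<^esub> y) \<otimes>\<^bsub>group_ring G\<^esub> z
        = x \<otimes>\<^bsub>group_ring G\<^esub> z \<oplus>\<^bsub>group_ring G\<^esub> y \<otimes>\<^bsub>group_ring G\<^esub> z"
      using group_ring_mult_diff_left[of G "x + y" y z] by (simp add: sel)
    show "z \<otimes>\<^bsub>group_ring G\<^esub> (x \<oplus>\<^bsub>group_ring G\<^esub> y)
        = z \<otimes>\<^bsub>group_ring G\<^esub> x \<oplus>\<^bsub>group_ring G\<^esub> z \<otimes>\<^bsub>group_ring G\<^esub> y"
      using group_ring_mult_diff_right[of G z "x + y" y] by (simp add: sel)
  qed
qed

lemma augmentation_ideal_is_ideal:
  assumes "monoid G"
  shows "ideal (augmentation_ideal G) (group_ring G)"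
proof -
  interpret ring "group_ring G" by (rule group_ring_is_ring[OF assms])
  have sel: "\<zero>\<^bsub>group_ring G\<^esub> = 0" "\<And>a b. a \<oplus>\<^bsub>group_ring G\<^esub> b = a + b"
    by (simp_all add: group_ring_def)
  have minus: "augmentation (\<ominus>\<^bsub>group_ring G\<^esub> a) = - augmentation a"
    if "a \<in> carrier (group_ring G)" for a
    using l_neg[OF that] augmentation_add[of "\<ominus>\<^bsub>group_ring G\<^esub> a" a] by (simp add: sel)
  show ?thesis
  proof (rule idealI[OF ring_axioms])
    show "subgroup (augmentation_ideal G) (add_monoid (group_ring G))"
    proof (rule subgroup.intro)
      fix x y assume "x \<in> augmentation_ideal G" "y \<in> augmentation_ideal G"
      then show "x \<otimes>\<^bsub>add_monoid (group_ring G)\<^esub> y \<in> augmentation_ideal G"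
        using a_closed[of x y] by (simp add: augmentation_ideal_def sel augmentation_add)
    next
      fix x assume "x \<in> augmentation_ideal G"
      then show "inv\<^bsub>add_monoid (group_ring G)\<^esub> x \<in> augmentation_ideal G"
        using minus[of x] a_inv_closed[of x] by (simp add: augmentation_ideal_def a_inv_def)
    next
      show "\<one>\<^bsub>add_monoid (group_ring G)\<^esub> \<in> augmentation_ideal G"
        using zero_closed by (simp add: augmentation_ideal_def sel)
    qed (auto simp: augmentation_ideal_def)
  qed (auto simp: augmentation_ideal_def augmentation_mult)
qed

end

theory Submission
  imports Defs
begin

text \<open>
  A nontrivial unit is detected in one of the quotients \<open>G/\<gamma>\<^sub>n(G)\<close>, because an element of
  the group ring involves only finitely many group elements.

  A group homomorphism \<open>h : G \<rightarrow> H\<close> extends linearly to a unital ring homomorphism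
  \<open>\<int>G \<rightarrow> \<int>H\<close> that preserves the augmentation. It therefore carries \<open>\<Delta>\<^sup>n(G)\<close> into
  \<open>\<Delta>\<^sup>n(H)\<close> and \<open>V\<^sub>\<omega>(\<int>G)\<close> into \<open>V\<^sub>\<omega>(\<int>H)\<close> (lemma \<open>group_ring_map_omega\<close>). So if
  \<open>u \<in> V\<^sub>\<omega>(\<int>G)\<close>, the hypothesis on the quotients says that \<open>u\<close> and \<open>1\<close> have the same image in
  \<open>\<int>[G/\<gamma>\<^sub>n(G)]\<close> for every \<open>n\<close>.

  Residual nilpotence means that the decreasing normal subgroups \<open>\<gamma>\<^sub>n(G)\<close> intersect trivially
  (lemma \<open>residually_nilpotent_separates\<close>), so for large \<open>n\<close> the subgroup \<open>\<gamma>\<^sub>n(G)\<close> contains no quotient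
  \<open>x y\<^sup>-\<^sup>1\<close> of two distinct elements of the finite set \<open>supp(u) \<union> {1}\<close>. For such \<open>n\<close> the projection
  \<open>G \<rightarrow> G/\<gamma>\<^sub>n(G)\<close> is injective on that set (lemma \<open>finite_set_separated\<close>), hence its linear
  extension is injective on the elements supported there (lemma \<open>group_ring_map_inj\<close>), and
  \<open>u = 1\<close>.
\<close>

section \<open>The lower central series\<close>

lemma lower_central_1 [simp]: "lower_central G (Suc 0) = carrier G"
  by (simp add: lower_central_def)

lemma lower_central_Suc:
  assumes "n \<ge> 1"
  shows "lower_central G (Suc n) = commutator_subgroup G (lower_central G n) (carrier G)"
  using assms by (cases n) (auto simp: lower_central_def)

text \<open>
  The generating commutators are permuted by conjugation:
  \<open>g [h, k] g\<^sup>-\<^sup>1 = [g h g\<^sup>-\<^sup>1, g k g\<^sup>-\<^sup>1]\<close>.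
\<close>

lemma commutator_subgroup_normal:
  assumes "H \<lhd> G" "K \<lhd> G"
  shows "commutator_subgroup G H K \<lhd> G"
proof -
  interpret H: normal H G by fact
  interpret K: normal K G by fact
  let ?C = "\<Union>h\<in>H. \<Union>k\<in>K. {h \<otimes>\<^bsub>G\<^esub> k \<otimes>\<^bsub>G\<^esub> inv\<^bsub>G\<^esub> h \<otimes>\<^bsub>G\<^esub> inv\<^bsub>G\<^esub> k}"
  show ?thesis
    unfolding commutator_subgroup_def
  proof (rule H.normal_generateI)
    show "?C \<subseteq> carrier G"
      using H.mem_carrier K.mem_carrier by auto
  next
    fix c g assume "c \<in> ?C" and g: "g \<in> carrier G"
    then obtain h k where h: "h \<in> H" and k: "k \<in> K"
      and c: "c = h \<otimes>\<^bsub>G\<^esub> k \<otimes>\<^bsub>G\<^esub> inv\<^bsub>G\<^esub> h \<otimes>\<^bsub>G\<^esub> inv\<^bsub>G\<^esub> k"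
      by auto
    define h' k' where h'_def: "h' = g \<otimes>\<^bsub>G\<^esub> h \<otimes>\<^bsub>G\<^esub> inv\<^bsub>G\<^esub> g"
      and k'_def: "k' = g \<otimes>\<^bsub>G\<^esub> k \<otimes>\<^bsub>G\<^esub> inv\<^bsub>G\<^esub> g"
    have "h' \<in> H" "k' \<in> K"
      unfolding h'_def k'_def using g h k by (auto intro: H.inv_op_closed2 K.inv_op_closed2)
    moreover have
      "g \<otimes>\<^bsub>G\<^esub> c \<otimes>\<^bsub>G\<^esub> inv\<^bsub>G\<^esub> g = h' \<otimes>\<^bsub>G\<^esub> k' \<otimes>\<^bsub>G\<^esub> inv\<^bsub>G\<^esub> h' \<otimes>\<^bsub>G\<^esub> inv\<^bsub>G\<^esub> k'"
    proof -
      have cancel: "inv\<^bsub>G\<^esub> g \<otimes>\<^bsub>G\<^esub> (g \<otimes>\<^bsub>G\<^esub> x) = x" if "x \<in> carrier G" for x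
        using g that by (simp flip: H.m_assoc)
      show ?thesis
        using g H.mem_carrier[OF h] K.mem_carrier[OF k]
        by (simp add: c h'_def k'_def H.inv_mult_group H.m_assoc cancel)
    qed
    ultimately show "g \<otimes>\<^bsub>G\<^esub> c \<otimes>\<^bsub>G\<^esub> inv\<^bsub>G\<^esub> g \<in> ?C"
      by blast
  qed
qed

lemma commutator_subgroup_incl:
  assumes "H \<lhd> G"
  shows "commutator_subgroup G H (carrier G) \<subseteq> H"
proof -
  interpret H: normal H G by fact
  have "h \<otimes>\<^bsub>G\<^esub> k \<otimes>\<^bsub>G\<^esub> inv\<^bsub>G\<^esub> h \<otimes>\<^bsub>G\<^esub> inv\<^bsub>G\<^esub> k \<in> H" if "h \<in> H" "k \<in> carrier G" for h k
  proof -
    \<comment> \<open>The commutator is \<open>h\<close> times a conjugate of \<open>h\<^sup>-\<^sup>1\<close>.\<close>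
    have "h \<otimes>\<^bsub>G\<^esub> (k \<otimes>\<^bsub>G\<^esub> inv\<^bsub>G\<^esub> h \<otimes>\<^bsub>G\<^esub> inv\<^bsub>G\<^esub> k) \<in> H"
      using that by (simp add: H.inv_op_closed2)
    then show ?thesis
      using that H.mem_carrier by (simp add: H.m_assoc)
  qed
  then show ?thesis
    unfolding commutator_subgroup_def
    by (intro H.generate_subgroup_incl H.subgroup_axioms) auto
qed

lemma lower_central_normal:
  assumes "group G" "n \<ge> 1"
  shows "lower_central G n \<lhd> G"
  using assms(2)
proof (induction n rule: nat_induct_at_least)
  case base
  show ?case using group.normal_self[OF assms(1)] by simp
next
  case (Suc n)
  then show ?case
    using group.normal_self[OF assms(1)]
    by (simp add: lower_central_Suc commutator_subgroup_normal)
qed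

lemma lower_central_antimono:
  assumes "group G" "1 \<le> m" "m \<le> n"
  shows "lower_central G n \<subseteq> lower_central G m"
  using assms(3)
proof (induction n rule: dec_induct)
  case (step n)
  then show ?case
    using commutator_subgroup_incl[OF lower_central_normal[OF assms(1)], of n] assms(2)
    by (force simp: lower_central_Suc)
qed simp

lemma (in group_hom) commutator_subgroup_img_subset:
  assumes "A \<subseteq> carrier G" "B \<subseteq> carrier G" "h ` A \<subseteq> A'" "h ` B \<subseteq> B'"
  shows "h ` commutator_subgroup G A B \<subseteq> commutator_subgroup H A' B'"
proof -
  let ?C = "\<Union>a\<in>A. \<Union>b\<in>B. {a \<otimes>\<^bsub>G\<^esub> b \<otimes>\<^bsub>G\<^esub> inv\<^bsub>G\<^esub> a \<otimes>\<^bsub>G\<^esub> inv\<^bsub>G\<^esub> b}"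
  let ?C' = "\<Union>a\<in>A'. \<Union>b\<in>B'. {a \<otimes>\<^bsub>H\<^esub> b \<otimes>\<^bsub>H\<^esub> inv\<^bsub>H\<^esub> a \<otimes>\<^bsub>H\<^esub> inv\<^bsub>H\<^esub> b}"
  have C: "?C \<subseteq> carrier G"
    using assms(1,2) by blast
  have "h c \<in> ?C'" if "c \<in> ?C" for c
  proof -
    from that obtain a b where ab: "a \<in> A" "b \<in> B"
      and c: "c = a \<otimes>\<^bsub>G\<^esub> b \<otimes>\<^bsub>G\<^esub> inv\<^bsub>G\<^esub> a \<otimes>\<^bsub>G\<^esub> inv\<^bsub>G\<^esub> b"
      by auto
    have "a \<in> carrier G" "b \<in> carrier G" using ab assms(1,2) by auto
    then have "h c = h a \<otimes>\<^bsub>H\<^esub> h b \<otimes>\<^bsub>H\<^esub> inv\<^bsub>H\<^esub> h a \<otimes>\<^bsub>H\<^esub> inv\<^bsub>H\<^esub> h b"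
      by (simp add: c)
    then show ?thesis using ab assms(3,4) by blast
  qed
  then have "h ` ?C \<subseteq> ?C'" by blast
  then show ?thesis
    unfolding commutator_subgroup_def generate_img[OF C, symmetric]
    by (rule H.mono_generate)
qed

lemma (in group_hom) lower_central_img_subset:
  assumes "n \<ge> 1"
  shows "h ` lower_central G n \<subseteq> lower_central H n"
  using assms
proof (induction n rule: nat_induct_at_least)
  case base
  show ?case by auto
next
  case (Suc n)
  have "lower_central G n \<subseteq> carrier G"
    using lower_central_normal[OF G.group_axioms Suc.hyps]
    by (blast dest: normal_imp_subgroup subgroup.subset)
  then show ?case
    unfolding lower_central_Suc[OF Suc.hyps]
    by (intro commutator_subgroup_img_subset Suc.IH) auto
qed

text \<open>
  If \<open>G/N\<close> is nilpotent, then \<open>\<gamma>\<^sub>n(G)\<close> maps into \<open>\<gamma>\<^sub>n(G/N) = 1\<close> for some \<open>n\<close>, so it lies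
  in \<open>N\<close> and misses every \<open>x\<close> outside \<open>N\<close>.
\<close>

lemma residually_nilpotent_separates:
  assumes "residually_nilpotent G" "x \<in> carrier G" "x \<noteq> \<one>\<^bsub>G\<^esub>"
  obtains n where "n \<ge> 1" "x \<notin> lower_central G n"
proof -
  obtain N where N: "N \<lhd> G" "x \<notin> N" and nil: "nilpotent_group (G Mod N)"
    using assms by (auto simp: residually_nilpotent_def)
  interpret N: normal N G by (rule N(1))
  interpret h: group_hom G "G Mod N" "\<lambda>g. N #>\<^bsub>G\<^esub> g"
    using N.r_coset_hom_Mod N.factorgroup_is_group
    by (simp add: group_hom_def group_hom_axioms_def N.group_axioms)
  obtain n where n: "n \<ge> 1" "lower_central (G Mod N) n = {\<one>\<^bsub>G Mod N\<^esub>}"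
    using nil by (auto simp: nilpotent_group_def)
  have "x \<notin> lower_central G n"
  proof
    assume "x \<in> lower_central G n"
    then have "N #>\<^bsub>G\<^esub> x = N"
      using h.lower_central_img_subset[OF n(1)] n(2) by auto
    then show False
      using N.rcos_self[OF assms(2) N.subgroup_axioms] N(2) by simp
  qed
  with n(1) show thesis by (rule that)
qed

text \<open>
  Two elements \<open>x\<close>, \<open>y\<close> fall into different cosets once \<open>x y\<^sup>-\<^sup>1\<close> has left the series. The indices
  at which this happens for the finitely many pairs have a common upper bound.
\<close>

lemma finite_set_separated:
  assumes "residually_nilpotent G" "finite S" "S \<subseteq> carrier G"
  obtains n where "n \<ge> 1" "inj_on (\<lambda>g. lower_central G n #>\<^bsub>G\<^esub> g) S"
proof -
  interpret group G using assms(1) by (simp add: residually_nilpotent_def)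
  define D where "D = (\<lambda>(x, y). x \<otimes>\<^bsub>G\<^esub> inv\<^bsub>G\<^esub> y) ` (S \<times> S) - {\<one>\<^bsub>G\<^esub>}"
  have "finite D" using assms(2) by (simp add: D_def)
  have "\<exists>n\<ge>1. d \<notin> lower_central G n" if "d \<in> D" for d
  proof -
    have "d \<in> carrier G" "d \<noteq> \<one>\<^bsub>G\<^esub>"
      using that assms(3) by (auto simp: D_def)
    then show ?thesis
      using residually_nilpotent_separates[OF assms(1)] by metis
  qed
  then obtain f where f: "\<And>d. d \<in> D \<Longrightarrow> f d \<ge> 1 \<and> d \<notin> lower_central G (f d)"
    by metis
  \<comment> \<open>Including 1 keeps the maximum defined when \<open>S\<close> has at most one element.\<close>
  define n where "n = Max (insert 1 (f ` D))"
  have n: "n \<ge> 1" "\<And>d. d \<in> D \<Longrightarrow> f d \<le> n"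
    using \<open>finite D\<close> by (auto simp: n_def)
  interpret N: normal "lower_central G n" G
    by (rule lower_central_normal[OF group_axioms n(1)])
  have "inj_on (\<lambda>g. lower_central G n #>\<^bsub>G\<^esub> g) S"
  proof (rule inj_onI, rule ccontr)
    fix x y assume xy: "x \<in> S" "y \<in> S" "x \<noteq> y"
      and eq: "lower_central G n #>\<^bsub>G\<^esub> x = lower_central G n #>\<^bsub>G\<^esub> y"
    have carr: "x \<in> carrier G" "y \<in> carrier G" using xy assms(3) by auto
    have "x \<otimes>\<^bsub>G\<^esub> inv\<^bsub>G\<^esub> y \<noteq> \<one>\<^bsub>G\<^esub>"
      using carr xy(3) by (metis inv_closed inv_equality inv_inv)
    then have D: "x \<otimes>\<^bsub>G\<^esub> inv\<^bsub>G\<^esub> y \<in> D" using xy by (force simp: D_def)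
    have "x \<in> lower_central G n #>\<^bsub>G\<^esub> y"
      using rcos_self[OF carr(1) N.subgroup_axioms] eq by simp
    then have "x \<otimes>\<^bsub>G\<^esub> inv\<^bsub>G\<^esub> y \<in> lower_central G n"
      using N.rcos_module_imp[OF group_axioms carr(2)] by simp
    then show False
      using lower_central_antimono[OF group_axioms] f[OF D] n(2)[OF D] by blast
  qed
  with n(1) show thesis by (rule that)
qed


section \<open>Functoriality of the group ring\<close>

definition group_ring_map :: "('a \<Rightarrow> 'c) \<Rightarrow> ('a \<Rightarrow>\<^sub>0 int) \<Rightarrow> ('c \<Rightarrow>\<^sub>0 int)" where
  "group_ring_map h = frag_extend (frag_of \<circ> h)"

lemma group_ring_map_frag_of [simp]: "group_ring_map h (frag_of x) = frag_of (h x)"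
  by (simp add: group_ring_map_def)

lemma group_ring_map_zero [simp]: "group_ring_map h 0 = 0"
  by (simp add: group_ring_map_def)

lemma group_ring_map_add: "group_ring_map h (a + b) = group_ring_map h a + group_ring_map h b"
  by (simp add: group_ring_map_def frag_extend_add)

lemma group_ring_map_diff: "group_ring_map h (a - b) = group_ring_map h a - group_ring_map h b"
  by (simp add: group_ring_map_def frag_extend_diff)

lemma augmentation_group_ring_map: "augmentation (group_ring_map h a) = augmentation a"
  by (simp add: group_ring_map_def augmentation_frag_extend[where c = 1])

text \<open>A left inverse of \<open>h\<close> on \<open>S\<close> extends linearly to a left inverse on the span of \<open>S\<close>.\<close>

lemma group_ring_map_inj:
  assumes "inj_on h S"
  shows "inj_on (group_ring_map h) {a. Poly_Mapping.keys a \<subseteq> S}"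
proof (rule inj_on_inverseI)
  fix a :: "'a \<Rightarrow>\<^sub>0 int" assume "a \<in> {a. Poly_Mapping.keys a \<subseteq> S}"
  then have keys: "Poly_Mapping.keys a \<subseteq> S" by simp
  have "group_ring_map (inv_into S h) (group_ring_map h a)
      = frag_extend ((frag_of \<circ> inv_into S h) \<circ> h) a"
    by (simp add: group_ring_map_def frag_extend_compose)
  also have "\<dots> = frag_extend frag_of a"
    using keys by (intro frag_extend_eq) (auto simp: inv_into_f_f[OF assms])
  finally show "group_ring_map (inv_into S h) (group_ring_map h a) = a"
    using frag_expansion[of a] by simp
qed

lemma (in group_hom) group_ring_map_hom:
  "group_ring_map h \<in> ring_hom (group_ring G) (group_ring H)"
proof (rule ring_hom_memI)
  fix a assume "a \<in> carrier (group_ring G)"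
  then have "Poly_Mapping.keys a \<subseteq> carrier G" by (simp add: group_ring_def)
  then have "Poly_Mapping.keys (group_ring_map h a) \<subseteq> carrier H"
    unfolding group_ring_map_def by (intro order_trans[OF keys_frag_extend]) auto
  then show "group_ring_map h a \<in> carrier (group_ring H)" by (simp add: group_ring_def)
next
  fix a b assume "a \<in> carrier (group_ring G)" "b \<in> carrier (group_ring G)"
  then have a: "Poly_Mapping.keys a \<subseteq> carrier G" and b: "Poly_Mapping.keys b \<subseteq> carrier G"
    by (simp_all add: group_ring_def)
  have *: "group_ring_map h (frag_of x \<otimes>\<^bsub>group_ring G\<^esub> b)
      = frag_of (h x) \<otimes>\<^bsub>group_ring H\<^esub> group_ring_map h b" if "x \<in> carrier G" for x
    using b
    by (induction rule: frag_induction)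
       (use that in \<open>auto simp: group_ring_mult_diff_right group_ring_mult_frag_of
          group_ring_map_diff\<close>)
  show "group_ring_map h (a \<otimes>\<^bsub>group_ring G\<^esub> b)
      = group_ring_map h a \<otimes>\<^bsub>group_ring H\<^esub> group_ring_map h b"
    using a
    by (induction rule: frag_induction)
       (use * in \<open>auto simp: group_ring_mult_diff_left group_ring_map_diff\<close>)
  show "group_ring_map h (a \<oplus>\<^bsub>group_ring G\<^esub> b)
      = group_ring_map h a \<oplus>\<^bsub>group_ring H\<^esub> group_ring_map h b"
    by (simp add: group_ring_def group_ring_map_add)
next
  show "group_ring_map h \<one>\<^bsub>group_ring G\<^esub> = \<one>\<^bsub>group_ring H\<^esub>"
    by (simp add: group_ring_def)
qed


section \<open>The filtration of the normalized units\<close>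

lemma augmentation_power_0: "augmentation_power G 0 = carrier (group_ring G)"
  by (simp add: augmentation_power_def ideals_set_def nat_pow_def)

lemma augmentation_power_Suc:
  "augmentation_power G (Suc n)
    = ideal_prod (group_ring G) (augmentation_power G n) (augmentation_ideal G)"
  by (simp add: augmentation_power_def ideals_set_def nat_pow_def)

lemma augmentation_power_is_ideal:
  assumes "monoid G"
  shows "ideal (augmentation_power G n) (group_ring G)"
proof -
  interpret ring "group_ring G" by (rule group_ring_is_ring[OF assms])
  show ?thesis
    by (induction n)
       (auto simp: augmentation_power_0 augmentation_power_Suc oneideal
         intro: ideal_prod_is_ideal augmentation_ideal_is_ideal[OF assms])
qed

lemma (in group_hom) group_ring_map_augmentation_power:
  assumes "a \<in> augmentation_power G n"
  shows "group_ring_map h a \<in> augmentation_power H n"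
  using assms
proof (induction n arbitrary: a)
  case 0
  then show ?case
    using ring_hom_closed[OF group_ring_map_hom] by (simp add: augmentation_power_0)
next
  case (Suc n)
  interpret R: ring "group_ring G" by (rule group_ring_is_ring) (rule G.monoid_axioms)
  have ideals: "ideal (augmentation_power G n) (group_ring G)"
      "ideal (augmentation_ideal G) (group_ring G)"
    by (simp_all add: augmentation_power_is_ideal augmentation_ideal_is_ideal G.monoid_axioms)
  have prod_carrier: "ideal_prod (group_ring G) (augmentation_power G n) (augmentation_ideal G)
      \<subseteq> carrier (group_ring G)"
    by (rule R.ideal_prod_in_carrier[OF ideals])
  have "a \<in> ideal_prod (group_ring G) (augmentation_power G n) (augmentation_ideal G)"
    using Suc.prems by (simp add: augmentation_power_Suc)
  then have "group_ring_map h a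
      \<in> ideal_prod (group_ring H) (augmentation_power H n) (augmentation_ideal H)"
  proof (induction rule: ideal_prod.induct)
    case (prod i j)
    have carr: "i \<in> carrier (group_ring G)" "j \<in> carrier (group_ring G)"
      using prod ideals by (auto dest: ideal.Icarr)
    have "group_ring_map h j \<in> augmentation_ideal H"
      using prod(2) ring_hom_closed[OF group_ring_map_hom carr(2)]
      by (simp add: augmentation_ideal_def augmentation_group_ring_map)
    then show ?case
      using Suc.IH[OF prod(1)]
      by (simp add: ring_hom_mult[OF group_ring_map_hom carr] ideal_prod.prod)
  next
    case (sum s t)
    then have "s \<in> carrier (group_ring G)" "t \<in> carrier (group_ring G)"
      using prod_carrier by auto
    with sum show ?case
      by (simp add: ring_hom_add[OF group_ring_map_hom] ideal_prod.sum)
  qed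
  then show ?case by (simp add: augmentation_power_Suc)
qed

lemma (in group_hom) group_ring_map_units:
  assumes "u \<in> normalized_units G"
  shows "group_ring_map h u \<in> normalized_units H"
proof -
  let ?\<phi> = "group_ring_map h"
  obtain v where u: "u \<in> carrier (group_ring G)" and v: "v \<in> carrier (group_ring G)"
    and uv: "v \<otimes>\<^bsub>group_ring G\<^esub> u = \<one>\<^bsub>group_ring G\<^esub>" "u \<otimes>\<^bsub>group_ring G\<^esub> v = \<one>\<^bsub>group_ring G\<^esub>"
    using assms by (auto simp: normalized_units_def Units_def)
  have "?\<phi> v \<otimes>\<^bsub>group_ring H\<^esub> ?\<phi> u = \<one>\<^bsub>group_ring H\<^esub>"
    "?\<phi> u \<otimes>\<^bsub>group_ring H\<^esub> ?\<phi> v = \<one>\<^bsub>group_ring H\<^esub>"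
    using u v uv group_ring_map_hom by (metis ring_hom_mult ring_hom_one)+
  moreover have "?\<phi> u \<in> carrier (group_ring H)" "?\<phi> v \<in> carrier (group_ring H)"
    using u v ring_hom_closed[OF group_ring_map_hom] by auto
  ultimately show ?thesis
    using assms by (auto simp: normalized_units_def Units_def augmentation_group_ring_map)
qed

lemma (in group_hom) group_ring_map_omega:
  assumes "u \<in> normalized_units_omega G"
  shows "group_ring_map h u \<in> normalized_units_omega H"
proof -
  have "group_ring_map h u \<in> normalized_units_level H n" if "n \<ge> 1" for n
  proof -
    have u: "u \<in> normalized_units_level G n"
      using assms that by (auto simp: normalized_units_omega_def)
    then obtain d where d: "d \<in> augmentation_power G n"
      and u_eq: "u = \<one>\<^bsub>group_ring G\<^esub> \<oplus>\<^bsub>group_ring G\<^esub> d"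
      by (auto simp: normalized_units_level_def a_l_coset_def l_coset_def)
    have "group_ring_map h u = \<one>\<^bsub>group_ring H\<^esub> \<oplus>\<^bsub>group_ring H\<^esub> group_ring_map h d"
      by (simp add: u_eq group_ring_def group_ring_map_add)
    then have "group_ring_map h u
        \<in> \<one>\<^bsub>group_ring H\<^esub> <+\<^bsub>group_ring H\<^esub> augmentation_power H n"
      using group_ring_map_augmentation_power[OF d] by (auto simp: a_l_coset_def l_coset_def)
    moreover have "group_ring_map h u \<in> normalized_units H"
      using u by (intro group_ring_map_units) (simp add: normalized_units_level_def)
    ultimately show ?thesis by (simp add: normalized_units_level_def)
  qed
  then show ?thesis by (simp add: normalized_units_omega_def)
qed

lemma one_in_normalized_units_omega:
  assumes "monoid G"
  shows "\<one>\<^bsub>group_ring G\<^esub> \<in> normalized_units_omega G"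
proof -
  interpret ring "group_ring G" by (rule group_ring_is_ring[OF assms])
  have "augmentation \<one>\<^bsub>group_ring G\<^esub> = 1"
    by (simp add: group_ring_def)
  then have "\<one>\<^bsub>group_ring G\<^esub> \<in> normalized_units G"
    by (simp add: normalized_units_def)
  moreover have "\<one>\<^bsub>group_ring G\<^esub> \<in> \<one>\<^bsub>group_ring G\<^esub> <+\<^bsub>group_ring G\<^esub> augmentation_power G n" for n
  proof -
    have "\<zero>\<^bsub>group_ring G\<^esub> \<in> augmentation_power G n"
      using augmentation_power_is_ideal[OF assms]
      by (simp add: additive_subgroup.zero_closed ideal.axioms(1))
    then show ?thesis
      unfolding a_l_coset_def l_coset_def by force
  qed
  ultimately show ?thesis
    by (simp add: normalized_units_omega_def normalized_units_level_def)
qed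


section \<open>Units of the group ring of a residually nilpotent group\<close>

theorem theorem14:
  fixes G :: "('a, 'b) monoid_scheme"
  assumes "group G"
    and "residually_nilpotent G"
    and "\<And>n. n \<ge> 1 \<Longrightarrow>
      normalized_units_omega (G Mod lower_central G n)
        = {\<one>\<^bsub>group_ring (G Mod lower_central G n)\<^esub>}"
  shows "normalized_units_omega G = {\<one>\<^bsub>group_ring G\<^esub>}"
proof -
  interpret group G by fact
  have one: "\<one>\<^bsub>group_ring G\<^esub> = frag_of \<one>\<^bsub>G\<^esub>"
    by (simp add: group_ring_def)
  have "u = \<one>\<^bsub>group_ring G\<^esub>" if u: "u \<in> normalized_units_omega G" for u
  proof -
    have "u \<in> carrier (group_ring G)"
      using u by (auto simp: normalized_units_omega_def normalized_units_level_def
          normalized_units_def Units_def)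
    then have keys: "Poly_Mapping.keys u \<subseteq> carrier G"
      by (simp add: group_ring_def)
    let ?S = "insert \<one>\<^bsub>G\<^esub> (Poly_Mapping.keys u)"
    obtain n where n: "n \<ge> 1" and inj: "inj_on (\<lambda>g. lower_central G n #>\<^bsub>G\<^esub> g) ?S"
      using finite_set_separated[OF assms(2), of ?S] keys by auto
    let ?h = "\<lambda>g. lower_central G n #>\<^bsub>G\<^esub> g"
    interpret N: normal "lower_central G n" G
      by (rule lower_central_normal[OF group_axioms n])
    interpret h: group_hom G "G Mod lower_central G n" ?h
      using N.r_coset_hom_Mod N.factorgroup_is_group
      by (simp add: group_hom_def group_hom_axioms_def group_axioms)
    have "group_ring_map ?h u = \<one>\<^bsub>group_ring (G Mod lower_central G n)\<^esub>"
      using h.group_ring_map_omega[OF u] assms(3)[OF n] by blast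
    also have "\<dots> = group_ring_map ?h \<one>\<^bsub>group_ring G\<^esub>"
      by (rule ring_hom_one[OF h.group_ring_map_hom, symmetric])
    finally show ?thesis
      by (rule inj_onD[OF group_ring_map_inj[OF inj]]) (auto simp: one)
  qed
  then show ?thesis
    using one_in_normalized_units_omega[OF monoid_axioms] by blast
qed

end
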